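(* Let $m\ge1$ and let $A_{k\ell}\in\mathbb C^{n_k\times n_k}$ ($k=1,\dots,m$, $\ell=0,\dots,m$) be Hermitian matrices such that the associated multiparameter eigenvalue problem is right definite and left definite (with respect to some $\mu\in\mathbb R^m$). Let $\lambda^{\mathbf 1}\in\mathbb R^m$ be the eigenvalue of multiindex $\mathbf 1=(1,\dots,1)$. Then for every initial choice $u_k^{(0)}\in\mathcal U_k$, $k=1,\dots,m$, every sequence $(\lambda^{(j)})_{j\ge1}$ generated by the Newton iteration for multiindex $\mathbf 1$ (described in the context) converges to $\lambda^{\mathbf 1}$.
   Context: $\mathcal U_k$ is the set of unit vectors in $\mathbb C^{n_k}$, and $\mathsf H$ denotes conjugate transpose. The multiparameter eigenvalue problem (MEP) asks for $\lambda=(\lambda_1,\dots,\lambda_m)$ and $u_k\in\mathcal U_k$ with $\bigl(A_{k0}+\sum_{\ell=1}^m\lambda_\ell A_{k\ell}\bigr)u_k=0$ for $k=1,\dots,m$; such a $\lambda$ is an eigenvalue. An eigenvalue $\lambda\in\mathbb R^m$ has multiindex $\mathbf i=(i_1,\dots,i_m)$ if, for each $k$, $0$ is the $i_k$-th largest eigenvalue (counted with multiplicity) of $A_{k0}+\sum_{\ell=1}^m\lambda_\ell A_{k\ell}$. For a right definite MEP it is known that for each multiindex $\mathbf i\in\prod_k\{1,\dots,n_k\}$ there is exactly one eigenvalue $\lambda^{\mathbf i}\in\mathbb R^m$ of multiindex $\mathbf i$. Right definite: $\det\bigl(u_k^{\mathsf H}A_{k\ell}u_k\bigr)_{k,\ell=1}^m>0$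 for all $u_k\in\mathcal U_k$, $k=1,\dots,m$. Left definite with respect to $\mu=(\mu_1,\dots,\mu_m)\in\mathbb R^m$: the matrices $A_{10},\dots,A_{m0}$ are negative definite and, for every $k=1,\dots,m$ and all $u_1\in\mathcal U_1,\dots,u_m\in\mathcal U_m$, the determinant of the $m\times m$ matrix obtained from $\bigl(u_p^{\mathsf H}A_{p\ell}u_p\bigr)_{p,\ell=1}^m$ by replacing its $k$-th row by $(\mu_1,\dots,\mu_m)$ is positive. Newton iteration for multiindex $\mathbf 1$: given $u^{(j-1)}_1,\dots,u^{(j-1)}_m$, for $j=1,2,\dots$: (1) let $\lambda^{(j)}\in\mathbb R^m$ be the unique solution of the linear system $(u_k^{(j-1)})^{\mathsf H}A_{k0}u_k^{(j-1)}+\sum_{\ell=1}^m\lambda^{(j)}_\ell (u_k^{(j-1)})^{\mathsf H}A_{k\ell}u_k^{(j-1)}=0$, $k=1,\dots,m$ (unique by right definiteness); (2) for each $k$, let $u_k^{(j)}\in\mathcal U_k$ be any unit eigenvector of $A_{k0}+\sum_{\ell=1}^m\lambda^{(j)}_\ell A_{k\ell}$ corresponding to its largest eigenvalue. *)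

theory Defs
  imports
    "Jordan_Normal_Form.Schur_Decomposition"
    "HOL-Analysis.Analysis"
begin

text \<open>
  The sizes n k of the matrices vary with the equation index k, so the matrices and the vectors
  they act on use the dimension-as-data types of Jordan_Normal_Form.  The number m of parameters
  is fixed throughout, so equation and parameter indices range over a finite type 'm with
  CARD('m) = m \<ge> 1, and the parameters, \<mu> and the m-by-m determinants use HOL-Analysis vectors
  and matrices.  The coefficients are split into A0 k (the paper's column 0) and A k l.
\<close>

no_notation Matrix.vec_index (infixl "$" 100)

definition unit_vectors :: "nat \<Rightarrow> complex Matrix.vec set" where
  "unit_vectors n = {u \<in> carrier_vec n. u \<bullet>c u = 1}"

definition hermitian_mat :: "complex mat \<Rightarrow> bool" where
  "hermitian_mat B \<longleftrightarrow> mat_adjoint B = B"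

text \<open>The form \<open>u\<^sup>H B u\<close>.  It is used for Hermitian matrices only, where it is real, so that
  taking the real part merely changes the type.\<close>

definition quad_form :: "complex mat \<Rightarrow> complex Matrix.vec \<Rightarrow> real" where
  "quad_form B u = Re ((B *\<^sub>v u) \<bullet>c u)"

definition negative_definite :: "nat \<Rightarrow> complex mat \<Rightarrow> bool" where
  "negative_definite n B \<longleftrightarrow>
     hermitian_mat B \<and> (\<forall>u \<in> carrier_vec n. u \<noteq> 0\<^sub>v n \<longrightarrow> quad_form B u < 0)"

text \<open>Eigenvalues of a Hermitian matrix, repeated according to multiplicity, in decreasing order;
  again \<open>Re\<close> only changes the type.\<close>

definition eigenvalues_desc :: "complex mat \<Rightarrow> real list" where
  "eigenvalues_desc B =
     rev (sorted_list_of_multiset (image_mset Re (proots (char_poly B))))"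

text \<open>The index i counts from 1 and is meaningful only for i between 1 and the size of B.\<close>

definition nth_largest_eigenvalue :: "nat \<Rightarrow> complex mat \<Rightarrow> real" where
  "nth_largest_eigenvalue i B = eigenvalues_desc B ! (i - 1)"

definition mep_pencil ::
  "('m::finite \<Rightarrow> complex mat) \<Rightarrow> ('m \<Rightarrow> 'm \<Rightarrow> complex mat) \<Rightarrow> complex ^ 'm \<Rightarrow> 'm \<Rightarrow> complex mat"
where
  "mep_pencil A0 A lam k =
     Matrix.mat (dim_row (A0 k)) (dim_col (A0 k))
       (\<lambda>(i, j). A0 k $$ (i, j) + (\<Sum>l\<in>UNIV. lam $ l * A k l $$ (i, j)))"

definition complex_of_real_vec :: "real ^ 'm \<Rightarrow> complex ^ 'm" where
  "complex_of_real_vec x = (\<chi> l. complex_of_real (x $ l))"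

definition mep_eigenvalue ::
  "('m::finite \<Rightarrow> nat) \<Rightarrow> ('m \<Rightarrow> complex mat) \<Rightarrow> ('m \<Rightarrow> 'm \<Rightarrow> complex mat) \<Rightarrow> complex ^ 'm \<Rightarrow> bool"
where
  "mep_eigenvalue n A0 A lam \<longleftrightarrow>
     (\<forall>k. \<exists>u \<in> unit_vectors (n k). mep_pencil A0 A lam k *\<^sub>v u = 0\<^sub>v (n k))"

definition mep_eigenvalue_of_multiindex ::
  "('m::finite \<Rightarrow> nat) \<Rightarrow> ('m \<Rightarrow> complex mat) \<Rightarrow> ('m \<Rightarrow> 'm \<Rightarrow> complex mat) \<Rightarrow> ('m \<Rightarrow> nat) \<Rightarrow> real ^ 'm \<Rightarrow> bool"
where
  "mep_eigenvalue_of_multiindex n A0 A i lam \<longleftrightarrow>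
     mep_eigenvalue n A0 A (complex_of_real_vec lam) \<and>
     (\<forall>k. i k \<in> {1..n k} \<and>
          nth_largest_eigenvalue (i k) (mep_pencil A0 A (complex_of_real_vec lam) k) = 0)"

definition right_definite ::
  "('m::finite \<Rightarrow> nat) \<Rightarrow> ('m \<Rightarrow> 'm \<Rightarrow> complex mat) \<Rightarrow> bool"
where
  "right_definite n A \<longleftrightarrow>
     (\<forall>u. (\<forall>k. u k \<in> unit_vectors (n k)) \<longrightarrow>
          Determinants.det (\<chi> k l. quad_form (A k l) (u k)) > 0)"

definition left_definite ::
  "('m::finite \<Rightarrow> nat) \<Rightarrow> ('m \<Rightarrow> complex mat) \<Rightarrow> ('m \<Rightarrow> 'm \<Rightarrow> complex mat) \<Rightarrow> real ^ 'm \<Rightarrow> bool"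
where
  "left_definite n A0 A \<mu> \<longleftrightarrow>
     (\<forall>k. negative_definite (n k) (A0 k)) \<and>
     (\<forall>k u. (\<forall>p. u p \<in> unit_vectors (n p)) \<longrightarrow>
          Determinants.det (\<chi> p l. if p = k then \<mu> $ l else quad_form (A p l) (u p)) > 0)"

text \<open>The vectors u j are indexed by j = 0, 1, 2, \<dots> and the parameters lam j by j = 1, 2, \<dots>;
  lam 0 is unconstrained.  For a right definite problem the linear system
  determines lam (j + 1) uniquely.\<close>

definition newton_iteration ::
  "('m::finite \<Rightarrow> nat) \<Rightarrow> ('m \<Rightarrow> complex mat) \<Rightarrow> ('m \<Rightarrow> 'm \<Rightarrow> complex mat)
     \<Rightarrow> (nat \<Rightarrow> 'm \<Rightarrow> complex Matrix.vec) \<Rightarrow> (nat \<Rightarrow> real ^ 'm) \<Rightarrow> bool"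
where
  "newton_iteration n A0 A u lam \<longleftrightarrow>
     (\<forall>k. u 0 k \<in> unit_vectors (n k)) \<and>
     (\<forall>j. (\<forall>k. quad_form (A0 k) (u j k)
                  + (\<Sum>l\<in>UNIV. lam (Suc j) $ l * quad_form (A k l) (u j k)) = 0) \<and>
          (\<forall>k. let B = mep_pencil A0 A (complex_of_real_vec (lam (Suc j))) k in
                 u (Suc j) k \<in> unit_vectors (n k) \<and>
                 eigenvector B (u (Suc j) k) (complex_of_real (nth_largest_eigenvalue 1 B))))"

end

theory Submission
  imports Defs
begin

text \<open>
  Let \<open>F k x\<close> be the largest eigenvalue of the \<open>k\<close>-th pencil at the parameter \<open>x\<close>.  By the Rayleigh
  bound it is the maximum of the affine functions \<open>x \<mapsto> w\<^sup>H P w\<close>, with \<open>P\<close> the pencil at \<open>x\<close> and \<open>w\<close>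
  a unit vector; so \<open>F\<close> is convex and a top eigenvector yields a supporting affine function.  The
  iteration is therefore Newton's method for the convex system \<open>F x = 0\<close>, with Jacobian the matrix
  of forms \<open>W\<close> at the current eigenvectors, and the sought eigenvalue \<open>z\<close> is a zero of \<open>F\<close>.

  From the first step on, convexity gives \<open>F (x j) \<ge> 0\<close>, that is \<open>W j (x j - x (j + 1)) \<ge> 0\<close>, and
  likewise \<open>W j (x (j + 1) - z) \<ge> 0\<close>, both entrywise.  These inequalities involve varying matrices.
  Left definiteness translates them into a common order: by Cramer's rule \<open>\<mu>\<close> is a combination of
  the rows of every matrix of forms with positive coefficients
  (\<open>weighted_rows_of_positive_replacements\<close>).  Hence \<open>\<mu> \<bullet> x j\<close> decreases and is bounded below by
  \<open>\<mu> \<bullet> z\<close>.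

  The unit spheres are compact, so the matrices of forms range over a compact set of invertible
  matrices, and \<open>\<mu> \<bullet> x\<close> dominates a multiple of \<open>\<parallel>x\<parallel>\<close> whenever \<open>W x \<ge> 0\<close> for one of
  these matrices (\<open>uniform_cone_bound\<close>).  This makes the steps, and thus \<open>F (x j)\<close>, tend to zero.
  The affine functions supporting \<open>F\<close> at \<open>z\<close> turn small residuals into small \<open>\<mu> \<bullet> (x j - z)\<close>, and
  the same cone bound turns this into \<open>x j \<longlonglongrightarrow> z\<close> (\<open>monotone_newton_convergence\<close>).
\<close>

section \<open>Compactness of the complex unit sphere\<close>

text \<open>Tychonoff, for the function type with its product topology.\<close>

lemma compact_product_of_compacts:
  fixes S :: "'i \<Rightarrow> 'a::topological_space set"
  assumes "\<And>i. compact (S i)"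
  shows "compact {f. \<forall>i. f i \<in> S i}"
proof -
  have "{f. \<forall>i. f i \<in> S i} = PiE UNIV S"
    by (auto simp: PiE_UNIV_domain)
  moreover have "compactin (product_topology (\<lambda>_. euclidean) UNIV) (PiE UNIV S)"
    using assms by (simp add: compactin_PiE)
  ultimately show ?thesis
    by (simp add: euclidean_product_topology)
qed

text \<open>Continuing the entries of a vector by zero places the unit spheres of all dimensions in one
  product space, where compactness and continuity can be discussed.  The zero tail keeps the set
  compact.\<close>

definition unit_sequences :: "nat \<Rightarrow> (nat \<Rightarrow> complex) set" where
  "unit_sequences n = {f. (\<forall>i\<ge>n. f i = 0) \<and> (\<Sum>i<n. (cmod (f i))\<^sup>2) = 1}"

lemma compact_unit_sequences: "compact (unit_sequences n)"
proof -
  have "closed {f::nat \<Rightarrow> complex. \<forall>i. n \<le> i \<longrightarrow> f i = 0}"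
    by (intro closed_Collect_all closed_Collect_imp closed_Collect_eq) auto
  moreover have "closed {f::nat \<Rightarrow> complex. (\<Sum>i<n. (cmod (f i))\<^sup>2) = 1}"
    by (intro closed_Collect_eq) (auto intro!: continuous_intros)
  moreover have "compact {f::nat \<Rightarrow> complex. \<forall>i. f i \<in> cball 0 1}"
    by (intro compact_product_of_compacts) auto
  ultimately have "compact ({f. \<forall>i. f i \<in> cball 0 1} \<inter>
      ({f::nat \<Rightarrow> complex. \<forall>i. n \<le> i \<longrightarrow> f i = 0} \<inter> {f. (\<Sum>i<n. (cmod (f i))\<^sup>2) = 1}))"
    by (intro compact_Int_closed closed_Int)
  moreover have "unit_sequences n \<subseteq> {f. \<forall>i. f i \<in> cball 0 1}"
  proof clarsimp
    fix f i assume f: "f \<in> unit_sequences n"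
    show "cmod (f i) \<le> 1"
    proof (cases "i < n")
      case True
      then have "(cmod (f i))\<^sup>2 \<le> (\<Sum>i<n. (cmod (f i))\<^sup>2)"
        by (intro member_le_sum) auto
      then have "(cmod (f i))\<^sup>2 \<le> 1\<^sup>2"
        using f by (simp add: unit_sequences_def)
      then show ?thesis
        by (rule power2_le_imp_le) simp
    qed (use f in \<open>auto simp: unit_sequences_def\<close>)
  qed
  then have "unit_sequences n = {f. \<forall>i. f i \<in> cball 0 1} \<inter>
      ({f::nat \<Rightarrow> complex. \<forall>i. n \<le> i \<longrightarrow> f i = 0} \<inter> {f. (\<Sum>i<n. (cmod (f i))\<^sup>2) = 1})"
    by (auto simp: unit_sequences_def)
  ultimately show ?thesis
    by simp
qed

lemma cscalar_prod_eq_sum: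
  fixes v w :: "complex Matrix.vec"
  assumes "w \<in> carrier_vec n"
  shows "v \<bullet>c w = (\<Sum>i<n. vec_index v i * cnj (vec_index w i))"
  using assms by (simp add: scalar_prod_def atLeast0LessThan)

lemma cscalar_prod_self:
  assumes "w \<in> carrier_vec n"
  shows "w \<bullet>c w = complex_of_real (\<Sum>i<n. (cmod (vec_index w i))\<^sup>2)"
  by (simp add: cscalar_prod_eq_sum[OF assms] complex_norm_square[symmetric] del: of_real_power)

lemma unit_vectors_eq_image: "unit_vectors n = Matrix.vec n ` unit_sequences n"
proof (intro equalityI subsetI)
  fix w assume "w \<in> unit_vectors n"
  then have w: "w \<in> carrier_vec n" "w \<bullet>c w = 1"
    by (auto simp: unit_vectors_def)
  let ?f = "\<lambda>i. if i < n then vec_index w i else 0"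
  have "?f \<in> unit_sequences n"
    using w(2) by (simp add: unit_sequences_def cscalar_prod_self[OF w(1)] flip: of_real_sum)
  moreover have "w = Matrix.vec n ?f"
    using w(1) by auto
  ultimately show "w \<in> Matrix.vec n ` unit_sequences n"
    by blast
next
  fix w assume "w \<in> Matrix.vec n ` unit_sequences n"
  then show "w \<in> unit_vectors n"
    by (auto simp: unit_sequences_def unit_vectors_def cscalar_prod_self[of _ n] simp del: of_real_sum)
qed

lemma mult_mat_vec_eq_sum:
  assumes "B \<in> carrier_mat n n" "w \<in> carrier_vec n" "i < n"
  shows "vec_index (B *\<^sub>v w) i = (\<Sum>j<n. B $$ (i, j) * vec_index w j)"
  using assms by (simp add: scalar_prod_def atLeast0LessThan)

lemma quad_form_eq_sum:
  assumes "B \<in> carrier_mat n n" "w \<in> carrier_vec n"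
  shows "quad_form B w =
    Re (\<Sum>i<n. \<Sum>j<n. B $$ (i, j) * vec_index w j * cnj (vec_index w i))"
  using assms by (simp add: quad_form_def cscalar_prod_eq_sum[of _ n] mult_mat_vec_eq_sum
      sum_distrib_right del: index_mult_mat_vec)

lemma continuous_on_quad_form [continuous_intros]:
  assumes "B \<in> carrier_mat n n" and f: "continuous_on S f"
  shows "continuous_on S (\<lambda>x. quad_form B (Matrix.vec n (f x)))"
proof -
  have *: "continuous_on S (\<lambda>x. f x i)" for i
    using f by (rule continuous_on_product_then_coordinatewise)
  have "quad_form B (Matrix.vec n (f x)) = Re (\<Sum>i<n. \<Sum>j<n. B $$ (i, j) * f x j * cnj (f x i))" for x
    by (simp add: quad_form_eq_sum[OF assms(1)])
  then show ?thesis
    by (simp only:) (intro continuous_intros *)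
qed

section \<open>The largest eigenvalue of a Hermitian matrix\<close>

lemma quad_form_max_attained:
  assumes B: "B \<in> carrier_mat n n" and n: "n > 0"
  obtains v where "v \<in> unit_vectors n"
    "\<And>w. w \<in> unit_vectors n \<Longrightarrow> quad_form B w \<le> quad_form B v"
proof -
  have "(\<lambda>i. if i = 0 then 1 else 0) \<in> unit_sequences n"
    using n by (simp add: unit_sequences_def sum.remove[of "{..<n}" 0])
  then have "unit_sequences n \<noteq> {}" by blast
  from continuous_attains_sup[OF compact_unit_sequences this
      continuous_on_quad_form[OF B continuous_on_id]]
  show ?thesis
    using that by (force simp: unit_vectors_eq_image)
qed

lemma hermitian_mat_iff:
  assumes "B \<in> carrier_mat n n"
  shows "hermitian_mat B \<longleftrightarrow> (\<forall>i<n. \<forall>j<n. cnj (B $$ (i, j)) = B $$ (j, i))"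
proof -
  have "mat_adjoint B \<in> carrier_mat n n"
    using assms by (auto simp: mat_adjoint_def)
  moreover have "mat_adjoint B $$ (j, i) = cnj (B $$ (i, j))" if "i < n" "j < n" for i j
    using assms that by (simp add: mat_adjoint_def mat_of_rows_index)
  ultimately show ?thesis
    using assms by (auto simp: hermitian_mat_def mat_eq_iff)
qed

lemma hermitian_form_swap:
  assumes B: "B \<in> carrier_mat n n" "hermitian_mat B"
    and xy: "x \<in> carrier_vec n" "y \<in> carrier_vec n"
  shows "(B *\<^sub>v x) \<bullet>c y = x \<bullet>c (B *\<^sub>v y)"
proof -
  have entry: "cnj (B $$ (i, j)) = B $$ (j, i)" if "i < n" "j < n" for i j
    using B that by (simp add: hermitian_mat_iff)
  have "(B *\<^sub>v x) \<bullet>c y = (\<Sum>i<n. \<Sum>j<n. B $$ (i, j) * vec_index x j * cnj (vec_index y i))"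
    using B(1) xy by (simp add: cscalar_prod_eq_sum[of _ n] mult_mat_vec_eq_sum sum_distrib_right
        del: index_mult_mat_vec)
  also have "\<dots> = (\<Sum>j<n. \<Sum>i<n. B $$ (i, j) * vec_index x j * cnj (vec_index y i))"
    by (rule sum.swap)
  also have "\<dots> = x \<bullet>c (B *\<^sub>v y)"
    using B(1) xy entry
    by (auto simp: cscalar_prod_eq_sum[of _ n] mult_mat_vec_eq_sum sum_distrib_left mult_ac
        simp del: index_mult_mat_vec intro!: sum.cong)
  finally show ?thesis .
qed

text \<open>Both sides scale by \<open>\<bar>t\<bar>\<^sup>2\<close> under \<open>w \<mapsto> t w\<close>, which allows normalising \<open>w\<close>.\<close>

lemma quad_form_le_on_carrier:
  assumes B: "B \<in> carrier_mat n n"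
    and le: "\<And>w. w \<in> unit_vectors n \<Longrightarrow> quad_form B w \<le> M"
    and w: "w \<in> carrier_vec n"
  shows "quad_form B w \<le> M * Re (w \<bullet>c w)"
proof -
  define s where "s = (\<Sum>i<n. (cmod (vec_index w i))\<^sup>2)"
  have s: "w \<bullet>c w = complex_of_real s"
    unfolding s_def by (rule cscalar_prod_self[OF w])
  have "s \<ge> 0" by (simp add: s_def sum_nonneg)
  show ?thesis
  proof (cases "s = 0")
    case True
    then have "w = 0\<^sub>v n" using s w by simp
    moreover have "quad_form B (0\<^sub>v n) = 0"
      using B by (simp add: quad_form_eq_sum[OF B])
    ultimately show ?thesis by simp
  next
    case False
    with \<open>s \<ge> 0\<close> have "s > 0" by simp
    define t where "t = 1 / sqrt s"
    have t: "t\<^sup>2 = 1 / s" using \<open>s > 0\<close> by (simp add: t_def power_divide)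
    let ?v = "complex_of_real t \<cdot>\<^sub>v w"
    have vi: "vec_index ?v i = complex_of_real t * vec_index w i" if "i < n" for i
      using that w by simp
    have v: "?v \<in> carrier_vec n" using w by simp
    have "?v \<bullet>c ?v = complex_of_real (t\<^sup>2 * s)"
      unfolding cscalar_prod_self[OF v] s_def
      by (simp add: vi norm_mult power_mult_distrib sum_distrib_left)
    then have "?v \<in> unit_vectors n"
      using v t \<open>s > 0\<close> by (simp add: unit_vectors_def)
    moreover have "quad_form B ?v = t\<^sup>2 * quad_form B w"
    proof -
      have "(\<Sum>i<n. \<Sum>j<n. B $$ (i, j) * vec_index ?v j * cnj (vec_index ?v i))
        = complex_of_real (t\<^sup>2) * (\<Sum>i<n. \<Sum>j<n. B $$ (i, j) * vec_index w j * cnj (vec_index w i))"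
        unfolding sum_distrib_left by (intro sum.cong refl) (simp add: vi power2_eq_square w)
      then show ?thesis
        by (simp only: quad_form_eq_sum[OF B v] quad_form_eq_sum[OF B w] Re_complex_of_real) simp
    qed
    ultimately have "t\<^sup>2 * quad_form B w \<le> M" using le[of ?v] by simp
    then show ?thesis
      using \<open>s > 0\<close> t s by (simp add: field_simps)
  qed
qed

text \<open>The variational argument for the largest eigenvalue.  With \<open>M\<close> the maximum and
  \<open>z = M v - B v\<close>, moving from \<open>v\<close> in the direction \<open>- z\<close> would increase the Rayleigh quotient to
  first order at the rate \<open>2 \<parallel>z\<parallel>\<^sup>2\<close>; hence \<open>z = 0\<close>.\<close>

lemma maximiser_is_eigenvector:
  assumes B: "B \<in> carrier_mat n n" "hermitian_mat B"
    and v: "v \<in> unit_vectors n"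
    and max: "\<And>w. w \<in> unit_vectors n \<Longrightarrow> quad_form B w \<le> quad_form B v"
  shows "B *\<^sub>v v = complex_of_real (quad_form B v) \<cdot>\<^sub>v v"
proof -
  define M where "M = quad_form B v"
  have vc: "v \<in> carrier_vec n" and v1: "v \<bullet>c v = 1"
    using v by (auto simp: unit_vectors_def)
  define z where "z = complex_of_real M \<cdot>\<^sub>v v - B *\<^sub>v v"
  have Bv: "B *\<^sub>v v \<in> carrier_vec n" and z: "z \<in> carrier_vec n" and Bz: "B *\<^sub>v z \<in> carrier_vec n"
    using B vc by (auto simp: z_def)
  define r where "r = Re (z \<bullet>c z)"
  have "r \<ge> 0" unfolding r_def by (simp add: cscalar_prod_self[OF z] sum_nonneg)
  have zz: "r = M * Re (v \<bullet>c z) - Re ((B *\<^sub>v v) \<bullet>c z)"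
  proof -
    have "z \<bullet>c z = (complex_of_real M \<cdot>\<^sub>v v) \<bullet>c z - (B *\<^sub>v v) \<bullet>c z"
      using vc Bv z by (subst (1) z_def) (simp add: minus_scalar_prod_distrib[of _ n])
    then show ?thesis using vc z by (simp add: r_def)
  qed
  have flip: "Re (x \<bullet>c y) = Re (y \<bullet>c x)" if "x \<in> carrier_vec n" "y \<in> carrier_vec n" for x y
    using that by (simp add: cscalar_prod_eq_sum[of _ n] Re_sum mult.commute)
  have expand: "Re ((x - complex_of_real t \<cdot>\<^sub>v y) \<bullet>c (v - complex_of_real t \<cdot>\<^sub>v z)) =
      Re (x \<bullet>c v) - t * (Re (x \<bullet>c z) + Re (y \<bullet>c v)) + t\<^sup>2 * Re (y \<bullet>c z)"
    if "x \<in> carrier_vec n" "y \<in> carrier_vec n" for x y t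
    using that vc z
    by (simp add: cscalar_prod_eq_sum[of _ n] Re_sum algebra_simps sum.distrib sum_subtractf
        sum_distrib_left power2_eq_square)
  \<comment> \<open>The bound by \<open>M\<close> at the perturbed vector \<open>v - t z\<close>: the constant terms agree because
    \<open>v\<close> attains the bound, and the linear terms differ by \<open>2 t r\<close>.\<close>
  have ineq: "2 * t * r \<le> t\<^sup>2 * (M * r - quad_form B z)" for t
  proof -
    define P where "P = Re ((B *\<^sub>v v) \<bullet>c z)"
    let ?w = "v - complex_of_real t \<cdot>\<^sub>v z"
    have "B *\<^sub>v ?w = B *\<^sub>v v - complex_of_real t \<cdot>\<^sub>v (B *\<^sub>v z)"
      using B vc z by (simp add: mult_minus_distrib_mat_vec mult_mat_vec)
    then have "quad_form B ?w = M - t * (Re ((B *\<^sub>v v) \<bullet>c z) + Re ((B *\<^sub>v z) \<bullet>c v)) + t\<^sup>2 * quad_form B z"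
      by (simp add: quad_form_def expand[OF Bv Bz] M_def)
    moreover have "Re ((B *\<^sub>v z) \<bullet>c v) = Re ((B *\<^sub>v v) \<bullet>c z)"
      using hermitian_form_swap[OF B z vc] flip[OF z Bv] by simp
    moreover have "Re (?w \<bullet>c ?w) = 1 - t * (2 * Re (v \<bullet>c z)) + t\<^sup>2 * r"
      using expand[OF vc z] v1 flip[OF z vc] by (simp add: r_def)
    moreover have "quad_form B ?w \<le> M * Re (?w \<bullet>c ?w)"
      using vc z by (intro quad_form_le_on_carrier[OF B(1)]) (auto simp: M_def max)
    ultimately have "M - t * (2 * P) + t\<^sup>2 * quad_form B z
        \<le> M * (1 - t * (2 * Re (v \<bullet>c z)) + t\<^sup>2 * r)"
      by (simp add: P_def)
    moreover have "P = M * Re (v \<bullet>c z) - r"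
      by (simp add: zz P_def)
    ultimately show ?thesis
      by (simp add: algebra_simps)
  qed
  have "r = 0"
  proof (rule ccontr)
    assume "r \<noteq> 0"
    with \<open>r \<ge> 0\<close> have "r > 0" by simp
    \<comment> \<open>The step \<open>t = r / q\<close> is so short that the linear term wins, since \<open>q\<close> exceeds the
      coefficient of \<open>t\<^sup>2\<close>.\<close>
    define q where "q = \<bar>M * r - quad_form B z\<bar> + 1"
    have "q > 0" by (simp add: q_def)
    have "2 * (r / q) * r \<le> (r / q)\<^sup>2 * q"
      using ineq[of "r / q"] by (rule order_trans) (intro mult_left_mono, auto simp: q_def)
    also have "\<dots> = (r / q) * r"
      using \<open>q > 0\<close> by (simp add: power2_eq_square)
    finally show False
      using \<open>r > 0\<close> \<open>q > 0\<close> by (simp add: zero_less_mult_iff field_simps)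
  qed
  then have "z \<bullet>c z = 0"
    unfolding r_def by (simp add: cscalar_prod_self[OF z])
  then have "z = 0\<^sub>v n"
    using z by simp
  then have "vec_index (complex_of_real M \<cdot>\<^sub>v v) i = vec_index (B *\<^sub>v v) i" if "i < n" for i
    using arg_cong[OF \<open>z = 0\<^sub>v n\<close>[unfolded z_def], of "\<lambda>x. vec_index x i"] that vc B(1) by auto
  then show ?thesis
    using vc Bv B by (intro eq_vecI) (auto simp flip: M_def)
qed

lemma eigenvalue_le_nth_largest_1:
  assumes B: "B \<in> carrier_mat n n" and ev: "eigenvalue B a"
  shows "Re a \<le> nth_largest_eigenvalue 1 B"
proof -
  define L where "L = sorted_list_of_multiset (image_mset Re (proots (char_poly B)))"
  have "char_poly B \<noteq> 0"
    using degree_monic_char_poly[OF B] by auto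
  then have "a \<in># proots (char_poly B)"
    using ev eigenvalue_root_char_poly[OF B] by simp
  then have "Re a \<in> set L"
    by (auto simp: L_def)
  then obtain i where i: "i < length L" "L ! i = Re a"
    by (auto simp: in_set_conv_nth)
  have "sorted L"
    by (simp add: L_def)
  then have "L ! i \<le> L ! (length L - 1)"
    using i by (intro sorted_nth_mono) auto
  moreover have "nth_largest_eigenvalue 1 B = rev L ! 0"
    by (simp add: nth_largest_eigenvalue_def eigenvalues_desc_def L_def)
  moreover have "rev L ! 0 = L ! (length L - 1)"
    using i by (subst rev_nth) auto
  ultimately show ?thesis
    using i by simp
qed

text \<open>The Rayleigh bound: the maximum of the form over the compact unit sphere is attained, and it is
  an eigenvalue, so it does not exceed the largest one.\<close>

lemma quad_form_le_largest_eigenvalue: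
  assumes B: "B \<in> carrier_mat n n" "hermitian_mat B" and w: "w \<in> unit_vectors n"
  shows "quad_form B w \<le> nth_largest_eigenvalue 1 B"
proof -
  have "n > 0"
    using w by (cases n) (auto simp: unit_vectors_def scalar_prod_def)
  then obtain v where v: "v \<in> unit_vectors n"
      and max: "\<And>w. w \<in> unit_vectors n \<Longrightarrow> quad_form B w \<le> quad_form B v"
    using quad_form_max_attained[OF B(1)] by metis
  have "eigenvalue B (complex_of_real (quad_form B v))"
    unfolding eigenvalue_def eigenvector_def
    using maximiser_is_eigenvector[OF B v max] v B
    by (intro exI[of _ v]) (auto simp: unit_vectors_def)
  from eigenvalue_le_nth_largest_1[OF B(1) this] max[OF w] show ?thesis
    by simp
qed

lemma quad_form_eigenvector:
  assumes "w \<in> unit_vectors n" "B *\<^sub>v w = complex_of_real a \<cdot>\<^sub>v w"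
  shows "quad_form B w = a"
  using assms by (simp add: quad_form_def unit_vectors_def)

section \<open>The pencil and the matrix of forms\<close>

lemma mep_pencil_carrier:
  "A0 k \<in> carrier_mat d d \<Longrightarrow> mep_pencil A0 A x k \<in> carrier_mat d d"
  by (auto simp: mep_pencil_def)

lemma hermitian_mep_pencil:
  assumes "A0 k \<in> carrier_mat d d" "hermitian_mat (A0 k)"
    and "\<And>l. A k l \<in> carrier_mat d d" "\<And>l. hermitian_mat (A k l)"
  shows "hermitian_mat (mep_pencil A0 A (complex_of_real_vec x) k)"
  using assms
  by (simp add: hermitian_mat_iff[of _ d] mep_pencil_carrier)
     (simp add: mep_pencil_def complex_of_real_vec_def)

text \<open>The form of the pencil is affine in the parameters.  So a fixed unit vector gives an affine
  function of the parameters that lies below the largest eigenvalue, and it touches it where the vector is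
  a top eigenvector.\<close>

lemma quad_form_mep_pencil:
  assumes A0: "A0 k \<in> carrier_mat d d" and A: "\<And>l. A k l \<in> carrier_mat d d"
    and w: "w \<in> carrier_vec d"
  shows "quad_form (mep_pencil A0 A (complex_of_real_vec x) k) w
    = quad_form (A0 k) w + (\<Sum>l\<in>UNIV. x $ l * quad_form (A k l) w)"
proof -
  let ?q = "\<lambda>B i j. B $$ (i, j) * vec_index w j * cnj (vec_index w i)"
  let ?P = "mep_pencil A0 A (complex_of_real_vec x) k"
  have "?q ?P i j = ?q (A0 k) i j + (\<Sum>l\<in>UNIV. complex_of_real (x $ l) * ?q (A k l) i j)"
    if "i < d" "j < d" for i j
    using that A0 by (simp add: mep_pencil_def complex_of_real_vec_def ring_distribs
        sum_distrib_right mult.assoc)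
  then have "(\<Sum>i<d. \<Sum>j<d. ?q ?P i j)
      = (\<Sum>i<d. \<Sum>j<d. ?q (A0 k) i j)
        + (\<Sum>i<d. \<Sum>j<d. \<Sum>l\<in>UNIV. complex_of_real (x $ l) * ?q (A k l) i j)"
    by (simp add: sum.distrib)
  also have "(\<Sum>i<d. \<Sum>j<d. \<Sum>l\<in>UNIV. complex_of_real (x $ l) * ?q (A k l) i j)
      = (\<Sum>l\<in>UNIV. complex_of_real (x $ l) * (\<Sum>i<d. \<Sum>j<d. ?q (A k l) i j))"
    by (simp add: sum_distrib_left sum.swap[of _ UNIV])
  finally show ?thesis
    by (simp add: quad_form_eq_sum[of _ d] A0 A w mep_pencil_carrier)
qed

definition form_matrix ::
  "('m::finite \<Rightarrow> 'm \<Rightarrow> complex mat) \<Rightarrow> ('m \<Rightarrow> complex Matrix.vec) \<Rightarrow> real^'m^'m"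
where
  "form_matrix A u = (\<chi> k l. quad_form (A k l) (u k))"

lemma form_matrix_mult_diff:
  assumes "\<And>k. A0 k \<in> carrier_mat (n k) (n k)" and "\<And>k l. A k l \<in> carrier_mat (n k) (n k)"
    and "\<And>k. u k \<in> unit_vectors (n k)"
  shows "(form_matrix A u *v (x - y)) $ k
    = quad_form (mep_pencil A0 A (complex_of_real_vec x) k) (u k)
      - quad_form (mep_pencil A0 A (complex_of_real_vec y) k) (u k)"
proof -
  have "u k \<in> carrier_vec (n k)"
    using assms(3)[of k] by (simp add: unit_vectors_def)
  then show ?thesis
    using assms(1,2)
    by (simp add: quad_form_mep_pencil[of _ _ "n k"] form_matrix_def matrix_vector_mult_def
        algebra_simps sum_subtractf)
qed

text \<open>The sphere of each component is the continuous image of a compact set of sequences, so the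
  product of the spheres is the image of a compact product.\<close>

lemma compact_form_matrices:
  fixes A :: "'m::finite \<Rightarrow> 'm \<Rightarrow> complex mat"
  assumes "\<And>k l. A k l \<in> carrier_mat (n k) (n k)"
  shows "compact {form_matrix A u | u. \<forall>k. u k \<in> unit_vectors (n k)}"
    (is "compact ?K")
proof -
  let ?g = "\<lambda>f. form_matrix A (\<lambda>k. Matrix.vec (n k) (f k))"
  let ?S = "{f. \<forall>k. f k \<in> unit_sequences (n k)}"
  have "?K \<subseteq> ?g ` ?S"
  proof clarify
    fix u assume u: "\<forall>k. u k \<in> unit_vectors (n k)"
    then obtain f where "\<And>k. f k \<in> unit_sequences (n k)" "\<And>k. u k = Matrix.vec (n k) (f k)"
      unfolding unit_vectors_eq_image image_iff by metis
    then show "form_matrix A u \<in> ?g ` ?S"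
      by (auto simp: form_matrix_def)
  qed
  moreover have "?g ` ?S \<subseteq> ?K"
    unfolding unit_vectors_eq_image by auto
  ultimately have K_eq: "?K = ?g ` ?S"
    by (rule subset_antisym)
  have "continuous_on ?S ?g"
  proof -
    have "continuous_on ?S (\<lambda>f. f k)" for k
      by (rule continuous_on_product_then_coordinatewise) (rule continuous_on_id)
    with assms show ?thesis
      unfolding form_matrix_def
      by (intro continuous_on_vec_lambda continuous_on_quad_form)
  qed
  moreover have "compact ?S"
    by (intro compact_product_of_compacts compact_unit_sequences)
  ultimately show ?thesis
    unfolding K_eq by (rule compact_continuous_image)
qed

section \<open>Monotone Newton sequences\<close>

text \<open>Cramer's rule for the transposed system: the vector \<open>\<mu>\<close> is a combination of the rows of \<open>W\<close>,
  and the weight of row \<open>k\<close> is the determinant with row \<open>k\<close> replaced by \<open>\<mu>\<close>, divided by the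
  determinant of \<open>W\<close>.  This is how left definiteness enters the proof.\<close>

lemma weighted_rows_of_positive_replacements:
  fixes W :: "real^'m^'m" and \<mu> :: "real^'m"
  assumes "det W > 0"
    and "\<And>k. det (\<chi> p. if p = k then \<mu> else W $ p) > 0"
  obtains c where "\<And>k. c $ k > 0" "\<And>x. inner \<mu> x = (\<Sum>k\<in>UNIV. c $ k * (W *v x) $ k)"
proof -
  define c :: "real^'m" where
    "c = (\<chi> k. det (\<chi> i j. if j = k then \<mu> $ i else transpose W $ i $ j) / det (transpose W))"
  have "transpose W *v c = \<mu>"
    using assms(1) cramer[of "transpose W" c \<mu>] by (simp add: c_def)
  then have \<mu>: "c v* W = \<mu>"
    by simp
  have "(\<chi> i j. if j = k then \<mu> $ i else transpose W $ i $ j)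
      = transpose (\<chi> p. if p = k then \<mu> else W $ p)" for k
    by (simp add: transpose_def vec_eq_iff)
  then have "c $ k > 0" for k
    using assms by (simp add: c_def)
  moreover have "inner \<mu> x = (\<Sum>k\<in>UNIV. c $ k * (W *v x) $ k)" for x
    using dot_lmul_matrix[of c W x] by (simp add: \<mu> inner_vec_def)
  ultimately show ?thesis
    using that by blast
qed

text \<open>For a single \<open>W\<close>, the vectors \<open>x\<close> with \<open>W x \<ge> 0\<close> form a closed cone on which \<open>\<mu> \<bullet> x\<close> vanishes
  only at \<open>0\<close>: it is a sum of the entries of \<open>W x\<close> with positive weights, and \<open>W\<close> is invertible.
  Compactness makes the resulting bound uniform in \<open>W\<close>.\<close>

lemma uniform_cone_bound:
  fixes K :: "(real^'m^'m) set" and \<mu> :: "real^'m"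
  assumes K: "compact K"
    and det: "\<And>W. W \<in> K \<Longrightarrow> det W > 0"
    and rep: "\<And>W k. W \<in> K \<Longrightarrow> det (\<chi> p. if p = k then \<mu> else W $ p) > 0"
  obtains \<gamma> where "\<gamma> > 0"
    "\<And>W x. W \<in> K \<Longrightarrow> (\<And>k. (W *v x) $ k \<ge> 0) \<Longrightarrow> \<gamma> * norm x \<le> inner \<mu> x"
proof -
  \<comment> \<open>By homogeneity in \<open>x\<close> it suffices to minimise over unit vectors \<open>x\<close> in the cone, and the
    pairs \<open>(W, x)\<close> with such \<open>x\<close> form a compact set on which \<open>\<mu> \<bullet> x\<close> is positive.\<close>
  define S where "S = (K \<times> sphere 0 1) \<inter> {p. \<forall>k. (fst p *v snd p) $ k \<ge> (0::real)}"
  have cl: "closed {p::(real^'m^'m) \<times> (real^'m). \<forall>k. (fst p *v snd p) $ k \<ge> (0::real)}"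
    unfolding matrix_vector_mult_def
    by (intro closed_Collect_all closed_Collect_le) (auto intro!: continuous_intros)
  have "compact S"
    unfolding S_def by (intro compact_Int_closed compact_Times K cl) auto
  have pos: "inner \<mu> (snd p) > 0" if "p \<in> S" for p
  proof -
    obtain W x where p: "p = (W, x)" by (cases p)
    have W: "W \<in> K" "norm x = 1" and nn: "\<And>k. (W *v x) $ k \<ge> 0"
      using that by (auto simp: S_def p)
    obtain c where c: "\<And>k. c $ k > 0" "\<And>x. inner \<mu> x = (\<Sum>k\<in>UNIV. c $ k * (W *v x) $ k)"
      using weighted_rows_of_positive_replacements[OF det rep] W(1) by metis
    have "invertible W"
      using det[OF W(1)] by (simp add: invertible_det_nz)
    then have "W *v x \<noteq> 0"
      using W(2) by (metis invertible_def matrix_left_invertible_ker norm_zero zero_neq_one)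
    then obtain k where "(W *v x) $ k \<noteq> 0"
      by (auto simp: vec_eq_iff)
    then have "c $ k * (W *v x) $ k > 0"
      using c(1)[of k] nn[of k] by simp
    then have "(\<Sum>k\<in>UNIV. c $ k * (W *v x) $ k) > 0"
      using c(1) nn by (intro sum_pos2[of _ k]) (auto simp: less_imp_le)
    then show ?thesis
      using c(2) by (simp add: p)
  qed
  obtain \<gamma> where \<gamma>: "\<gamma> > 0" "\<And>p. p \<in> S \<Longrightarrow> \<gamma> \<le> inner \<mu> (snd p)"
  proof (cases "S = {}")
    case True
    then show ?thesis using that[of 1] by auto
  next
    case False
    have "continuous_on S (\<lambda>p. inner \<mu> (snd p))"
      by (intro continuous_intros)
    from continuous_attains_inf[OF \<open>compact S\<close> False this] pos that show ?thesis
      by metis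
  qed
  have "\<gamma> * norm x \<le> inner \<mu> x" if W: "W \<in> K" and nn: "\<And>k. (W *v x) $ k \<ge> 0" for W x
  proof (cases "x = 0")
    case False
    have "(W *v (x /\<^sub>R norm x)) $ k \<ge> 0" for k
      using nn[of k] by (simp add: matrix_vector_mult_scaleR)
    then have "(W, x /\<^sub>R norm x) \<in> S"
      using False W by (auto simp: S_def)
    from \<gamma>(2)[OF this] False show ?thesis
      by (simp add: field_simps)
  qed simp
  with \<gamma>(1) that show ?thesis by blast
qed

text \<open>Newton's method for a convex system, stripped of its origin: \<open>W j\<close> is the Jacobian at \<open>x j\<close>,
  the vector \<open>W j (x j - x (j + 1))\<close> is the residual at \<open>x j\<close>, and \<open>z\<close> is the zero.  The hypothesis
  \<open>above\<close> says that the tangent planes at \<open>x j\<close> are nonpositive at \<open>z\<close>, and \<open>V_le\<close> that the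
  tangent planes at \<open>z\<close> lie below the residuals.  In the functional \<open>\<mu>\<close> the iterates decrease
  to a limit, so by the cone bound the steps and with them the residuals tend to zero.  Then
  \<open>V_le\<close> squeezes \<open>\<mu> \<bullet> (x j - z)\<close> to zero, and the cone bound once more gives \<open>x j \<longlonglongrightarrow> z\<close>.\<close>

lemma monotone_newton_convergence:
  fixes K :: "(real^'m^'m) set" and \<mu> z :: "real^'m" and x :: "nat \<Rightarrow> real^'m"
  assumes K: "compact K"
    and det: "\<And>W. W \<in> K \<Longrightarrow> det W > 0"
    and rep: "\<And>W k. W \<in> K \<Longrightarrow> det (\<chi> p. if p = k then \<mu> else W $ p) > 0"
    and WK: "\<And>j. W j \<in> K" and V: "V \<in> K"
    and step: "\<And>j k. (W j *v (x j - x (Suc j))) $ k \<ge> 0"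
    and above: "\<And>j k. (W j *v (x (Suc j) - z)) $ k \<ge> 0"
    and V_le: "\<And>j k. (V *v (x j - z)) $ k \<le> (W j *v (x j - x (Suc j))) $ k"
  shows "x \<longlonglongrightarrow> z"
proof -
  obtain \<gamma> where \<gamma>: "\<gamma> > 0"
    "\<And>W x. W \<in> K \<Longrightarrow> (\<And>k. (W *v x) $ k \<ge> 0) \<Longrightarrow> \<gamma> * norm x \<le> inner \<mu> x"
    using uniform_cone_bound[OF K det rep] by metis
  obtain c where c: "\<And>k. c $ k > 0" "\<And>x. inner \<mu> x = (\<Sum>k\<in>UNIV. c $ k * (V *v x) $ k)"
    using weighted_rows_of_positive_replacements[OF det rep] V by metis
  \<comment> \<open>\<open>f\<close> is a Lyapunov function: it decreases, it bounds the error, and its decrements bound the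
    steps.  The shift by one puts every argument within reach of \<open>above\<close>.\<close>
  define f where "f j = inner \<mu> (x (Suc j) - z)" for j
  have f_ge: "\<gamma> * norm (x (Suc j) - z) \<le> f j" for j
    unfolding f_def using \<gamma>(2)[OF WK above] .
  have f_step: "\<gamma> * norm (x (Suc j) - x (Suc (Suc j))) \<le> f j - f (Suc j)" for j
    using \<gamma>(2)[OF WK step] by (simp add: f_def algebra_simps)
  have "decseq f"
    unfolding decseq_Suc_iff
    using f_step \<gamma>(1) by (smt (verit) mult_nonneg_nonneg norm_ge_zero)
  moreover have "0 \<le> f j" for j
    using f_ge[of j] \<gamma>(1) by (smt (verit) mult_nonneg_nonneg norm_ge_zero)
  ultimately obtain L where L: "f \<longlonglongrightarrow> L"
    using decseq_convergent[of f 0] by blast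
  then have "(\<lambda>j. f j - f (Suc j)) \<longlonglongrightarrow> 0"
    using tendsto_diff[OF L LIMSEQ_Suc[OF L]] by simp
  then have "(\<lambda>j. (f j - f (Suc j)) / \<gamma>) \<longlonglongrightarrow> 0"
    using tendsto_divide[OF _ tendsto_const[of \<gamma>]] \<gamma>(1) by fastforce
  then have steps0: "(\<lambda>j. norm (x (Suc j) - x (Suc (Suc j)))) \<longlonglongrightarrow> 0"
    by (rule Lim_null_comparison[rotated])
       (use f_step \<gamma>(1) in \<open>auto simp: field_simps\<close>)
  have "bounded K" using K by (rule compact_imp_bounded)
  then obtain C where C: "\<And>W. W \<in> K \<Longrightarrow> norm W \<le> C"
    by (auto simp: bounded_iff)
  have W_bound: "(M *v y) $ k \<le> C * norm y" if "M \<in> K" for M y k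
  proof -
    have "(M *v y) $ k = inner (M $ k) y"
      by (simp add: matrix_vector_mult_def inner_vec_def)
    also have "\<dots> \<le> norm (M $ k) * norm y"
      by (rule norm_cauchy_schwarz)
    also have "\<dots> \<le> C * norm y"
      using C[OF that] Finite_Cartesian_Product.norm_nth_le[of M k] by (intro mult_right_mono) auto
    finally show ?thesis .
  qed
  \<comment> \<open>So far \<open>f\<close> might converge to a positive limit; the matrix \<open>V\<close> excludes this, by bounding
    \<open>f\<close> by the length of the next step.\<close>
  define D where "D = (\<Sum>k\<in>UNIV. c $ k) * C"
  have "f j \<le> D * norm (x (Suc j) - x (Suc (Suc j)))" for j
  proof -
    have "f j = (\<Sum>k\<in>UNIV. c $ k * (V *v (x (Suc j) - z)) $ k)"
      by (simp add: f_def c(2))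
    also have "\<dots> \<le> (\<Sum>k\<in>UNIV. c $ k * (C * norm (x (Suc j) - x (Suc (Suc j)))))"
      by (intro sum_mono mult_left_mono order_trans[OF V_le W_bound[OF WK]] less_imp_le c(1))
    finally show ?thesis
      by (simp add: D_def sum_distrib_right mult.assoc)
  qed
  then have "norm (x (Suc j) - z) * \<gamma> \<le> D * norm (x (Suc j) - x (Suc (Suc j)))" for j
    using order_trans[OF f_ge[of j]] by (simp only: mult.commute[of \<gamma>])
  then have "norm (x (Suc j) - z) \<le> D * norm (x (Suc j) - x (Suc (Suc j))) / \<gamma>" for j
    using \<gamma>(1) by (simp only: pos_le_divide_eq)
  note norm_bound = this
  have "(\<lambda>j. D / \<gamma> * norm (x (Suc j) - x (Suc (Suc j)))) \<longlonglongrightarrow> 0"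
    using tendsto_mult[OF tendsto_const[of "D / \<gamma>"] steps0] by simp
  then have bound0: "(\<lambda>j. D * norm (x (Suc j) - x (Suc (Suc j))) / \<gamma>) \<longlonglongrightarrow> 0"
    by (simp only: times_divide_eq_left)
  have "(\<lambda>j. x (Suc j) - z) \<longlonglongrightarrow> 0"
    by (rule Lim_null_comparison[OF always_eventually[OF allI[OF norm_bound]] bound0])
  then show ?thesis
    by (rule LIMSEQ_imp_Suc[OF LIM_zero_cancel])
qed

section \<open>Global convergence for the eigenvalue of the first multiindex\<close>

theorem theorem4p7:
  fixes n :: "'m::finite \<Rightarrow> nat"
    and A0 :: "'m \<Rightarrow> complex mat"
    and A :: "'m \<Rightarrow> 'm \<Rightarrow> complex mat"
    and \<mu> :: "real ^ 'm"
    and lam1 :: "real ^ 'm"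
    and u :: "nat \<Rightarrow> 'm \<Rightarrow> complex Matrix.vec"
    and lam :: "nat \<Rightarrow> real ^ 'm"
  assumes "\<And>k. A0 k \<in> carrier_mat (n k) (n k)"
    and "\<And>k. hermitian_mat (A0 k)"
    and "\<And>k l. A k l \<in> carrier_mat (n k) (n k)"
    and "\<And>k l. hermitian_mat (A k l)"
    and "right_definite n A"
    and "left_definite n A0 A \<mu>"
    and "mep_eigenvalue_of_multiindex n A0 A (\<lambda>_. 1) lam1"
    and "newton_iteration n A0 A u lam"
  shows "lam \<longlonglongrightarrow> lam1"
proof -
  note A0 = assms(1) and A0_herm = assms(2) and A = assms(3) and A_herm = assms(4)
  define P where "P x k = mep_pencil A0 A (complex_of_real_vec x) k" for x :: "real^'m" and k
  have P: "P x k \<in> carrier_mat (n k) (n k)" "hermitian_mat (P x k)" for x k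
    unfolding P_def
    using A0 A0_herm A A_herm by (simp_all add: mep_pencil_carrier hermitian_mep_pencil[of _ _ "n k"])
  have rayleigh: "quad_form (P x k) w \<le> nth_largest_eigenvalue 1 (P x k)"
    if "w \<in> unit_vectors (n k)" for x k w
    by (rule quad_form_le_largest_eigenvalue[OF P that])
  have diff: "(form_matrix A w *v (x - y)) $ k = quad_form (P x k) (w k) - quad_form (P y k) (w k)"
    if "\<And>k. w k \<in> unit_vectors (n k)" for w x y k
    unfolding P_def by (rule form_matrix_mult_diff[where n = n]) (use A0 A that in auto)

  have top1: "nth_largest_eigenvalue 1 (P lam1 k) = 0" for k
    using assms(7) by (simp add: mep_eigenvalue_of_multiindex_def P_def)
  \<comment> \<open>The null vectors \<open>v k\<close> at \<open>lam1\<close> are top eigenvectors there, because the largest eigenvalue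
    is \<open>0\<close>; they provide the tangent planes at the limit.\<close>
  have "\<exists>w. w \<in> unit_vectors (n k) \<and> P lam1 k *\<^sub>v w = 0\<^sub>v (n k)" for k
    using assms(7) by (auto simp: mep_eigenvalue_of_multiindex_def mep_eigenvalue_def P_def)
  then obtain v where v: "\<And>k. v k \<in> unit_vectors (n k)"
      and v0: "\<And>k. P lam1 k *\<^sub>v v k = 0\<^sub>v (n k)"
    by metis
  have qv: "quad_form (P lam1 k) (v k) = 0" for k
    using v[of k] by (simp add: quad_form_def v0 unit_vectors_def)

  have u: "u j k \<in> unit_vectors (n k)" for j k
    using assms(8) by (cases j) (auto simp: newton_iteration_def Let_def)
  have q_new: "quad_form (P (lam (Suc j)) k) (u j k) = 0" for j k
    using assms(8) u[of j k]
    by (simp add: newton_iteration_def P_def unit_vectors_def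
        quad_form_mep_pencil[of _ _ "n k"] A0 A)
  have q_top: "quad_form (P (lam (Suc j)) k) (u (Suc j) k)
      = nth_largest_eigenvalue 1 (P (lam (Suc j)) k)" for j k
    using assms(8)
    by (intro quad_form_eigenvector[OF u])
       (auto simp: newton_iteration_def Let_def eigenvector_def P_def)

  define K where "K = {form_matrix A w | w. \<forall>k. w k \<in> unit_vectors (n k)}"
  have "compact K"
    unfolding K_def by (rule compact_form_matrices) (rule A)
  moreover have "Determinants.det W > 0" if "W \<in> K" for W
    using that assms(5) by (auto simp: K_def right_definite_def form_matrix_def)
  moreover have "Determinants.det (\<chi> p. if p = k then \<mu> else W $ p) > 0" if W: "W \<in> K" for W k
  proof -
    obtain w where w: "\<forall>k. w k \<in> unit_vectors (n k)" and W: "W = form_matrix A w"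
      using W by (auto simp: K_def)
    have "(\<chi> p. if p = k then \<mu> else W $ p)
        = (\<chi> p l. if p = k then \<mu> $ l else quad_form (A p l) (w p))"
      by (simp add: W form_matrix_def vec_eq_iff)
    then show ?thesis
      using assms(6) w by (simp add: left_definite_def)
  qed
  moreover have "form_matrix A (u (Suc j)) \<in> K" for j
    unfolding K_def using u by blast
  moreover have "form_matrix A v \<in> K"
    unfolding K_def using v by blast
  \<comment> \<open>Each of the next three inequalities is the Rayleigh bound for one unit vector at one parameter:
    the previous vector at an iterate, the current vector at \<open>lam1\<close>, and \<open>v k\<close> at an iterate.
    The first needs a previous vector, so the sequence starts with \<open>lam 1\<close> and \<open>u 1\<close>.\<close>
  moreover have "(form_matrix A (u (Suc j)) *v (lam (Suc j) - lam (Suc (Suc j)))) $ k \<ge> 0" for j k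
    using rayleigh[OF u, of "lam (Suc j)" k j] by (simp add: diff u q_new q_top)
  moreover have "(form_matrix A (u (Suc j)) *v (lam (Suc (Suc j)) - lam1)) $ k \<ge> 0" for j k
    using rayleigh[OF u, of lam1 k "Suc j"] top1[of k] by (simp add: diff u q_new)
  moreover have "(form_matrix A v *v (lam (Suc j) - lam1)) $ k
      \<le> (form_matrix A (u (Suc j)) *v (lam (Suc j) - lam (Suc (Suc j)))) $ k" for j k
    using rayleigh[OF v, of "lam (Suc j)" k] by (simp add: diff u v qv q_new q_top)
  ultimately have "(\<lambda>j. lam (Suc j)) \<longlonglongrightarrow> lam1"
    by (rule monotone_newton_convergence[where x = "\<lambda>j. lam (Suc j)"
          and W = "\<lambda>j. form_matrix A (u (Suc j))"])
  then show ?thesis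
    by (rule LIMSEQ_imp_Suc)
qed

end
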